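(* Let $P_\Gamma=EC(0,\Gamma,\eta)$ be a non-degenerate elliptical distribution on $\mathbb{R}^p$ in its canonical representation, satisfying the marginal condition given in the context. Then for any nonempty subset $\mathcal{U}\subset S^{p-1}$, $$\mathcal{D}_{\mathcal{U}}(\Gamma,P_\Gamma)=\tfrac12 .$$
   Context: Elliptical distributions: $X\sim EC(0,\Sigma,\xi)$ on $\mathbb{R}^p$ means $X=\xi AU$ in distribution, where $A\in\mathbb{R}^{p\times r}$ is deterministic, $\Sigma=AA^T$, $U$ is uniform on the unit sphere of $\mathbb{R}^r$, and $\xi\ge0$ is a real random variable independent of $U$. If $s_{\min}(\Sigma)>0$ ($s_{\min}$ = smallest singular value; this is called non-degenerate), the law of $u^TX/\sqrt{u^T\Sigma u}$ does not depend on $u\in S^{p-1}=\{u\in\mathbb{R}^p:\|u\|=1\}$. $EC(0,\Gamma,\eta)$ is the canonical representation of such a distribution $EC(0,\Sigma,\xi)$ if $\Gamma=a^{-2}\Sigma$, $\eta=a\xi$ for some $a>0$, and $P_\Gamma\left(\frac{|u^TX|^2}{u^T\Gamma u}\le1\right)=\frac12$, where $P_\Gamma=EC(0,\Gamma,\eta)$; $\Gamma$ is the scatter matrix. Marginal condition (standing assumption): let $G(t)=P_\Gamma\left(\frac{|u^TX|^2}{u^T\Gamma u}\le t\right)$ (independent of $u$). $G$ is continuous at $t=1$ and there exist $\tau\in(0,1/2)$ and $\alpha,\kappa>0$ such that $\inf_{|t|\ge\alpha}|G(1)-G(1+t)|\ge\tau$ and $\inf_{0<|t|<\alpha}\frac{|G(1)-G(1+t)|}{|t|}\ge\kappa^{-1/2}$.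 Matrix depth: $\mathcal{D}_{\mathcal{U}}(\Gamma,\mathbb{P})=\inf_{u\in\mathcal{U}}\min\{\mathbb{P}\{|u^TX|^2\le u^T\Gamma u\},\ \mathbb{P}\{|u^TX|^2\ge u^T\Gamma u\}\}$, $X\sim\mathbb{P}$. *)

theory Defs
  imports "HOL-Probability.Probability"
begin

text \<open>
  The normalised surface measure of the unit sphere is the image of the uniform
  distribution on the unit ball under radial projection \<open>x \<mapsto> x / \<parallel>x\<parallel>\<close>
  (the origin, where \<^const>\<open>sgn\<close> is zero, is a null set).
\<close>

definition sphere_uniform :: "'a::euclidean_space measure" where
  "sphere_uniform = distr (uniform_measure lborel (ball 0 1)) borel sgn"

text \<open>
  \<open>elliptical TYPE('r) M P \<Sigma> \<xi>\<close>: \<open>P\<close> is the distribution \<open>EC(0, \<Sigma>, \<xi>)\<close>, where \<open>\<xi>\<close> is a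
  random variable on the probability space \<open>M\<close>. The number \<open>r\<close> of columns of \<open>A\<close> is the
  cardinality of the index type \<open>'r\<close>; it is an explicit parameter because, for given
  \<open>\<Sigma>\<close> and \<open>\<xi>\<close>, the law of \<open>\<xi> A U\<close> depends on \<open>r\<close> (but not on the choice of \<open>A\<close>).
  Independence of \<open>\<xi>\<close> and \<open>U\<close> is stated as equality of the joint law with the product of the
  laws, since \<open>indep_var\<close> requires both variables to have the same type.
\<close>

definition elliptical ::
  "'r::finite itself \<Rightarrow> 'w measure \<Rightarrow> (real ^ 'p::finite) measure \<Rightarrow> real ^ 'p ^ 'p \<Rightarrow> ('w \<Rightarrow> real) \<Rightarrow> bool"
  where
  "elliptical R M P \<Sigma> \<xi> \<longleftrightarrow>
     prob_space M \<and> \<xi> \<in> borel_measurable M \<and> (AE \<omega> in M. 0 \<le> \<xi> \<omega>) \<and>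
     (\<exists>(A :: real ^ 'r ^ 'p) (U :: 'w \<Rightarrow> real ^ 'r).
        \<Sigma> = A ** transpose A \<and>
        U \<in> borel_measurable M \<and> distr M borel U = sphere_uniform \<and>
        distr M (borel \<Otimes>\<^sub>M borel) (\<lambda>\<omega>. (\<xi> \<omega>, U \<omega>)) = distr M borel \<xi> \<Otimes>\<^sub>M distr M borel U \<and>
        P = distr M borel (\<lambda>\<omega>. \<xi> \<omega> *\<^sub>R (A *v U \<omega>)))"

definition singular_values :: "real ^ 'n ^ 'm \<Rightarrow> real set" where
  "singular_values B =
     {s. 0 \<le> s \<and> (\<exists>v. v \<noteq> 0 \<and> (transpose B ** B) *v v = s\<^sup>2 *\<^sub>R v)}"

text \<open>The set of singular values is finite and nonempty, so its infimum is its minimum.\<close>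

definition s_min :: "real ^ 'n ^ 'm \<Rightarrow> real" where
  "s_min B = Inf (singular_values B)"

text \<open>
  \<open>marginal_cdf P \<Gamma>\<close> is the function \<open>G\<close>: the common value over all unit vectors \<open>u\<close>. That
  this value exists for a non-degenerate elliptical \<open>P\<close> is not built into the definition.
\<close>

definition marginal_cdf :: "(real ^ 'p::finite) measure \<Rightarrow> real ^ 'p ^ 'p \<Rightarrow> real \<Rightarrow> real" where
  "marginal_cdf P \<Gamma> t =
     (THE g. \<forall>u\<in>sphere 0 1.
        measure P {x \<in> space P. \<bar>u \<bullet> x\<bar>\<^sup>2 / (u \<bullet> (\<Gamma> *v u)) \<le> t} = g)"

text \<open>
  Argument order: \<open>P = EC(0, \<Gamma>, \<eta>)\<close> is the canonical representation of \<open>EC(0, \<Sigma>, \<xi>)\<close>,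
  with \<open>\<xi>\<close> and \<open>\<eta>\<close> random variables on the same \<open>M\<close>.
\<close>

definition canonical_representation ::
  "'r::finite itself \<Rightarrow> 'w measure \<Rightarrow> (real ^ 'p::finite) measure \<Rightarrow> real ^ 'p ^ 'p \<Rightarrow> ('w \<Rightarrow> real) \<Rightarrow>
     real ^ 'p ^ 'p \<Rightarrow> ('w \<Rightarrow> real) \<Rightarrow> bool"
  where
  "canonical_representation R M P \<Gamma> \<eta> \<Sigma> \<xi> \<longleftrightarrow>
     elliptical R M P \<Gamma> \<eta> \<and>
     (\<exists>a>0. \<Gamma> = (1 / a\<^sup>2) *\<^sub>R \<Sigma> \<and> (\<forall>\<omega>\<in>space M. \<eta> \<omega> = a * \<xi> \<omega>)) \<and>
     marginal_cdf P \<Gamma> 1 = 1 / 2"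

definition marginal_condition :: "(real ^ 'p::finite) measure \<Rightarrow> real ^ 'p ^ 'p \<Rightarrow> bool" where
  "marginal_condition P \<Gamma> \<longleftrightarrow>
     (let G = marginal_cdf P \<Gamma> in
        isCont G 1 \<and>
        (\<exists>\<tau> \<alpha> \<kappa>. 0 < \<tau> \<and> \<tau> < 1 / 2 \<and> 0 < \<alpha> \<and> 0 < \<kappa> \<and>
           (INF t\<in>{t. \<alpha> \<le> \<bar>t\<bar>}. \<bar>G 1 - G (1 + t)\<bar>) \<ge> \<tau> \<and>
           (INF t\<in>{t. 0 < \<bar>t\<bar> \<and> \<bar>t\<bar> < \<alpha>}. \<bar>G 1 - G (1 + t)\<bar> / \<bar>t\<bar>) \<ge> \<kappa> powr (- 1 / 2)))"

definition matrix_depth ::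
  "(real ^ 'p::finite) set \<Rightarrow> real ^ 'p ^ 'p \<Rightarrow> (real ^ 'p) measure \<Rightarrow> real"
  where
  "matrix_depth \<U> \<Gamma> P =
     (INF u\<in>\<U>. min (measure P {x \<in> space P. \<bar>u \<bullet> x\<bar>\<^sup>2 \<le> u \<bullet> (\<Gamma> *v u)})
                    (measure P {x \<in> space P. \<bar>u \<bullet> x\<bar>\<^sup>2 \<ge> u \<bullet> (\<Gamma> *v u)}))"

end

theory Submission
  imports Defs
begin

text \<open>
  The depth condition in a direction \<open>u\<close> asks on which side of \<open>1\<close> the statistic
  \<open>Y u = \<bar>u \<bullet> X\<bar>\<^sup>2 / (u \<bullet> \<Gamma> u)\<close> falls, so everything reduces to two facts about \<open>Y u\<close>: its
  distribution function is \<open>G\<close> for every \<open>u\<close>, and \<open>G\<close> has no atom at \<open>1\<close>. The canonical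
  normalisation then gives \<open>P (Y u \<le> 1) = G 1 = 1/2\<close>, and continuity of \<open>G\<close> at \<open>1\<close> gives \<open>P (Y u \<ge> 1) = 1 - G 1 = 1/2\<close>. Both arguments of the
  minimum equal \<open>1/2\<close> in every direction, hence so does the infimum.

  Since \<^const>\<open>marginal_cdf\<close> is a definite description, that \<open>Y u\<close> has the same law for all \<open>u\<close>
  has to be proved before anything is known about \<open>G\<close>. Writing \<open>\<Gamma> = A A\<^sup>T\<close> and \<open>X = \<eta> A U\<close>, the
  variable \<open>u \<bullet> X / sqrt (u \<bullet> \<Gamma> u)\<close> equals \<open>\<eta> (w \<bullet> U)\<close> with the unit vector
  \<open>w = A\<^sup>T u / \<parallel>A\<^sup>T u\<parallel>\<close>. As \<open>U\<close> is independent of \<open>\<eta>\<close> and its law is invariant under rotations, the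
  law of \<open>\<eta> (w \<bullet> U)\<close> depends on \<open>w\<close> only through its norm (\<open>distr_elliptical_direction\<close>).
  Rotation invariance of \<open>U\<close> comes from that of Lebesgue measure
  (\<open>emeasure_lborel_orthogonal_vimage\<close>). The positive smallest singular value ensures
  \<open>u \<bullet> \<Gamma> u > 0\<close>, so that the normalisation makes sense.
\<close>

section \<open>Rotation invariance\<close>

text \<open>
  The usual uniqueness argument for translation-invariant measures. Both \<open>A\<close> and its preimage are
  compared with the unit ball \<open>B\<close> by computing the double integral of
  \<open>1\<^sub>B(y) 1\<^sub>A(f x + y)\<close> in two ways: the shift \<open>x \<mapsto> x - f\<^sup>-\<^sup>1 y\<close> makes it \<open>\<lambda>(B) \<lambda>(f\<^sup>-\<^sup>1 A)\<close>, the shift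
  \<open>y \<mapsto> y - f x\<close> makes it \<open>\<lambda>(A) \<lambda>(B)\<close>, because \<open>f\<close> maps unit balls to unit balls.
\<close>

lemma emeasure_lborel_orthogonal_vimage:
  fixes f :: "'a::euclidean_space \<Rightarrow> 'a"
  assumes f: "orthogonal_transformation f" and A[measurable]: "A \<in> sets borel"
  shows "emeasure lborel (f -` A) = emeasure lborel A"
proof -
  define B where "B = ball (0::'a) 1"
  have [measurable]: "B \<in> sets borel" by (simp add: B_def)
  have lin: "linear f" using f by (rule orthogonal_transformation_linear)
  have [measurable]: "f \<in> borel_measurable borel"
    using lin by (intro borel_measurable_continuous_onI linear_continuous_on) (simp add: linear_linear)
  have surj: "surj f" using f by (rule orthogonal_transformation_surj)
  have fA[measurable]: "f -` A \<in> sets borel"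
    using measurable_sets[of f borel borel A] by simp
  have shift: "(\<integral>\<^sup>+x. h (c + x) \<partial>lborel) = (\<integral>\<^sup>+x. h x \<partial>lborel)"
    if [measurable]: "h \<in> borel_measurable borel" for h :: "'a \<Rightarrow> ennreal" and c
    by (subst (2) lborel_distr_plus[of c, symmetric]) (simp add: nn_integral_distr)
  let ?I = "\<lambda>S x. indicator S x :: ennreal"
  have "emeasure lborel B * emeasure lborel (f -` A) = (\<integral>\<^sup>+y. (\<integral>\<^sup>+x. ?I B y * ?I A (f x) \<partial>lborel) \<partial>lborel)"
  proof -
    have "?I A (f x) = ?I (f -` A) x" for x by (simp add: indicator_def)
    then have "(\<integral>\<^sup>+x. ?I A (f x) \<partial>lborel) = emeasure lborel (f -` A)" by simp
    then have "(\<integral>\<^sup>+x. ?I B y * ?I A (f x) \<partial>lborel) = emeasure lborel (f -` A) * ?I B y" for y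
      by (subst nn_integral_cmult) (auto simp: mult.commute)
    then show ?thesis
      by (simp add: nn_integral_cmult_indicator) (rule mult.commute)
  qed
  also have "\<dots> = (\<integral>\<^sup>+y. (\<integral>\<^sup>+x. ?I B y * ?I A (f x + y) \<partial>lborel) \<partial>lborel)"
  proof (rule nn_integral_cong)
    fix y :: 'a
    obtain c where c: "f c = y" using surj by (metis surjD)
    have "(\<integral>\<^sup>+x. ?I B y * ?I A (f (c + x)) \<partial>lborel) = (\<integral>\<^sup>+x. ?I B y * ?I A (f x) \<partial>lborel)"
      by (rule shift) measurable
    then show "(\<integral>\<^sup>+x. ?I B y * ?I A (f x) \<partial>lborel) = (\<integral>\<^sup>+x. ?I B y * ?I A (f x + y) \<partial>lborel)"
      by (simp add: linear_add[OF lin] c add.commute)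
  qed
  also have "\<dots> = (\<integral>\<^sup>+x. (\<integral>\<^sup>+y. ?I B y * ?I A (f x + y) \<partial>lborel) \<partial>lborel)"
    by (rule lborel_pair.Fubini') measurable
  also have "\<dots> = (\<integral>\<^sup>+x. (\<integral>\<^sup>+y. ?I B (y - f x) * ?I A y \<partial>lborel) \<partial>lborel)"
  proof (rule nn_integral_cong)
    fix x :: 'a
    have "(\<integral>\<^sup>+y. ?I B ((f x + y) - f x) * ?I A (f x + y) \<partial>lborel)
        = (\<integral>\<^sup>+y. ?I B (y - f x) * ?I A y \<partial>lborel)"
      by (rule shift) measurable
    then show "(\<integral>\<^sup>+y. ?I B y * ?I A (f x + y) \<partial>lborel)
        = (\<integral>\<^sup>+y. ?I B (y - f x) * ?I A y \<partial>lborel)"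
      by simp
  qed
  also have "\<dots> = (\<integral>\<^sup>+y. (\<integral>\<^sup>+x. ?I B (y - f x) * ?I A y \<partial>lborel) \<partial>lborel)"
    by (rule lborel_pair.Fubini') measurable
  also have "\<dots> = (\<integral>\<^sup>+y. emeasure lborel B * ?I A y \<partial>lborel)"
  proof (rule nn_integral_cong)
    fix y :: 'a
    obtain c where c: "f c = y" using surj by (metis surjD)
    have "norm (y - f x) = dist c x" for x
      by (metis c dist_norm f linear_diff[OF lin] orthogonal_transformation_norm)
    then have "?I B (y - f x) = ?I (ball c 1) x" for x
      by (simp add: indicator_def B_def)
    then show "(\<integral>\<^sup>+x. ?I B (y - f x) * ?I A y \<partial>lborel) = emeasure lborel B * ?I A y"
      by (subst nn_integral_multc)
        (simp_all add: borel_measurable_indicator emeasure_ball B_def)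
  qed
  also have "\<dots> = emeasure lborel B * emeasure lborel A"
    by (simp add: nn_integral_cmult)
  finally have "emeasure lborel B * emeasure lborel (f -` A) = emeasure lborel B * emeasure lborel A" .
  moreover have "unit_ball_vol (real DIM('a)) \<noteq> 0"
    by (metis less_irrefl of_nat_0_le_iff unit_ball_vol_pos)
  ultimately show ?thesis
    by (simp add: ennreal_mult_cancel_left emeasure_ball B_def)
qed

lemma sets_sphere_uniform [simp, measurable_cong]: "sets sphere_uniform = sets borel"
  by (simp add: sphere_uniform_def)

lemma space_sphere_uniform [simp]: "space sphere_uniform = UNIV"
  by (simp add: sphere_uniform_def)

text \<open>
  Radial projection commutes with a rotation, and the unit ball is invariant under it.
\<close>

lemma emeasure_sphere_uniform_orthogonal_vimage:
  fixes f :: "'a::euclidean_space \<Rightarrow> 'a"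
  assumes f: "orthogonal_transformation f" and A[measurable]: "A \<in> sets borel"
  shows "emeasure sphere_uniform (f -` A) = emeasure sphere_uniform A"
proof -
  let ?B = "ball (0::'a) 1"
  have lin: "linear f" using f by (rule orthogonal_transformation_linear)
  have fm: "f \<in> borel_measurable borel"
    using lin by (intro borel_measurable_continuous_onI linear_continuous_on) (simp add: linear_linear)
  have vimage_borel: "g -` S \<in> sets borel" if "g \<in> borel_measurable borel" "S \<in> sets borel"
    for g :: "'a \<Rightarrow> 'a" and S
    using measurable_sets[OF that] by simp
  have S: "emeasure sphere_uniform S = emeasure lborel (?B \<inter> sgn -` S) / emeasure lborel ?B"
    if "S \<in> sets borel" for S :: "'a set"
    using that vimage_borel[of sgn S]
    by (simp add: sphere_uniform_def emeasure_distr borel_measurable_sgn)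
  have "sgn (f x) = f (sgn x)" for x
    by (simp add: sgn_div_norm linear_scale[OF lin] orthogonal_transformation_norm[OF f])
  then have "?B \<inter> sgn -` (f -` A) = f -` (?B \<inter> sgn -` A)"
    by (auto simp: orthogonal_transformation_norm[OF f])
  moreover have "?B \<inter> sgn -` A \<in> sets borel"
    by (intro sets.Int vimage_borel borel_measurable_sgn A) simp
  ultimately have "emeasure lborel (?B \<inter> sgn -` (f -` A)) = emeasure lborel (?B \<inter> sgn -` A)"
    using emeasure_lborel_orthogonal_vimage[OF f] by metis
  then show ?thesis
    by (simp only: S[OF A] S[OF vimage_borel[OF fm A]])
qed

text \<open>
  By Fubini it suffices to compare the sections of an event at each fixed \<open>e\<close>; such a section
  is a condition on \<open>w \<bullet> y\<close> alone, and a rotation carrying \<open>w\<close> to \<open>w'\<close> maps the section for \<open>w\<close>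
  onto the one for \<open>w'\<close>.
\<close>

lemma distr_pair_sphere_uniform_inner:
  fixes w w' :: "real ^ 'r::finite" and N :: "real measure"
  assumes N: "sets N = sets borel" and S: "prob_space (sphere_uniform :: (real ^ 'r) measure)"
    and "norm w = norm w'"
  shows "distr (N \<Otimes>\<^sub>M sphere_uniform) borel (\<lambda>(e, y). e * (w \<bullet> y))
       = distr (N \<Otimes>\<^sub>M sphere_uniform) borel (\<lambda>(e, y). e * (w' \<bullet> y))"
proof -
  note [measurable_cong] = N
  obtain f where f: "orthogonal_transformation f" and fw: "f w = w'"
    using orthogonal_transformation_exists[OF assms(3)] by blast
  interpret S: prob_space "sphere_uniform :: (real ^ 'r) measure" by (rule S)
  have [measurable]: "(\<lambda>(e, y). e * (v \<bullet> y)) \<in> borel_measurable (N \<Otimes>\<^sub>M sphere_uniform)"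
    for v :: "real ^ 'r" by measurable
  have sp: "space (N \<Otimes>\<^sub>M (sphere_uniform :: (real ^ 'r) measure)) = UNIV"
    using sets_eq_imp_space_eq[OF N] by (simp add: space_pair_measure)
  have eq: "emeasure (distr (N \<Otimes>\<^sub>M sphere_uniform) borel (\<lambda>(e, y). e * (v \<bullet> y))) B
      = (\<integral>\<^sup>+e. emeasure sphere_uniform {y. e * (v \<bullet> y) \<in> B} \<partial>N)"
    if [measurable]: "B \<in> sets borel" for v :: "real ^ 'r" and B
  proof -
    have "(\<lambda>(e, y). e * (v \<bullet> y)) -` B \<in> sets (N \<Otimes>\<^sub>M (sphere_uniform :: (real ^ 'r) measure))"
      using measurable_sets[of "\<lambda>(e, y). e * (v \<bullet> y)" "N \<Otimes>\<^sub>M sphere_uniform" borel B] sp by simp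
    then show ?thesis
      by (simp add: emeasure_distr sp S.emeasure_pair_measure_alt vimage_def)
  qed
  show ?thesis
  proof (rule measure_eqI)
    fix B :: "real set"
    assume "B \<in> sets (distr (N \<Otimes>\<^sub>M sphere_uniform) borel (\<lambda>(e, y). e * (w \<bullet> y)))"
    then have B[measurable]: "B \<in> sets borel" by simp
    have "emeasure sphere_uniform {y. e * (w \<bullet> y) \<in> B}
        = emeasure sphere_uniform {y. e * (w' \<bullet> y) \<in> B}" for e
    proof -
      have "{y. e * (w \<bullet> y) \<in> B} = f -` {y. e * (w' \<bullet> y) \<in> B}"
        using f fw by (auto simp: orthogonal_transformation_def)
      moreover have "{y. e * (w' \<bullet> y) \<in> B} \<in> sets borel"
      proof -
        have "{y \<in> space borel. e * (w' \<bullet> y) \<in> B} \<in> sets borel" by measurable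
        then show ?thesis by simp
      qed
      ultimately show ?thesis
        using emeasure_sphere_uniform_orthogonal_vimage[OF f] by metis
    qed
    then show "emeasure (distr (N \<Otimes>\<^sub>M sphere_uniform) borel (\<lambda>(e, y). e * (w \<bullet> y))) B
        = emeasure (distr (N \<Otimes>\<^sub>M sphere_uniform) borel (\<lambda>(e, y). e * (w' \<bullet> y))) B"
      by (simp add: eq B)
  qed simp
qed

section \<open>Marginals of elliptical distributions\<close>

lemma elliptical_space_sets:
  assumes "elliptical R M P \<Gamma> \<eta>"
  shows "sets P = sets borel" "space P = UNIV"
  using assms by (auto simp: elliptical_def)

lemma prob_space_elliptical:
  fixes P :: "(real ^ 'p::finite) measure"
  assumes "elliptical (R :: 'r::finite itself) M P \<Gamma> \<eta>"
  shows "prob_space P"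
proof -
  obtain A :: "real ^ 'r ^ 'p" and U where
    [measurable]: "\<eta> \<in> borel_measurable M" "U \<in> borel_measurable M"
    and P: "prob_space M" "P = distr M borel (\<lambda>\<omega>. \<eta> \<omega> *\<^sub>R (A *v U \<omega>))"
    using assms by (auto simp: elliptical_def)
  have [measurable]: "(*v) A \<in> borel_measurable borel"
    by (intro borel_measurable_continuous_onI continuous_intros)
  show ?thesis
    unfolding P(2) by (rule prob_space.prob_space_distr[OF P(1)]) measurable
qed

lemma quadratic_form_gram:
  fixes A :: "real ^ 'r ^ 'p"
  shows "u \<bullet> ((A ** transpose A) *v u) = (norm (transpose A *v u))\<^sup>2"
  by (simp add: power2_norm_eq_inner matrix_vector_mul_assoc[symmetric] dot_lmul_matrix[symmetric]
      transpose_matrix_vector)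

text \<open>A kernel vector would be a singular vector for the singular value \<open>0\<close>.\<close>

lemma s_min_pos_imp_mult_nonzero:
  assumes "s_min B > 0" and "v \<noteq> 0"
  shows "B *v v \<noteq> 0"
proof
  assume "B *v v = 0"
  then have "(transpose B ** B) *v v = 0\<^sup>2 *\<^sub>R v"
    by (simp add: matrix_vector_mul_assoc[symmetric])
  then have "0 \<in> singular_values B"
    using \<open>v \<noteq> 0\<close> by (auto simp: singular_values_def)
  moreover have "bdd_below (singular_values B)"
    by (rule bdd_belowI[of _ 0]) (simp add: singular_values_def)
  ultimately have "s_min B \<le> 0"
    unfolding s_min_def by (rule cInf_lower)
  with assms(1) show False by simp
qed

text \<open>
  Since \<open>u \<bullet> A y = A\<^sup>T u \<bullet> y\<close> and \<open>sqrt (u \<bullet> \<Gamma> u) = \<parallel>A\<^sup>T u\<parallel>\<close>, the normalised projection is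
  \<open>\<eta> (w \<bullet> U)\<close> with \<open>w\<close> the unit vector in the direction \<open>A\<^sup>T u\<close>. Positivity of the two quadratic
  forms makes both directions nonzero, so that a rotation connects the unit vectors.
\<close>

lemma distr_elliptical_direction:
  fixes P :: "(real ^ 'p::finite) measure" and u v :: "real ^ 'p"
  assumes ell: "elliptical (R :: 'r::finite itself) M P \<Gamma> \<eta>"
    and pos: "u \<bullet> (\<Gamma> *v u) > 0" "v \<bullet> (\<Gamma> *v v) > 0"
  shows "distr P borel (\<lambda>x. (u \<bullet> x) / sqrt (u \<bullet> (\<Gamma> *v u)))
       = distr P borel (\<lambda>x. (v \<bullet> x) / sqrt (v \<bullet> (\<Gamma> *v v)))"
proof -
  obtain A :: "real ^ 'r ^ 'p" and U where
    [measurable]: "\<eta> \<in> borel_measurable M" "U \<in> borel_measurable M"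
    and M: "prob_space M" and \<Gamma>: "\<Gamma> = A ** transpose A"
    and P: "P = distr M borel (\<lambda>\<omega>. \<eta> \<omega> *\<^sub>R (A *v U \<omega>))"
    and U: "distr M borel U = sphere_uniform"
    and indep: "distr M (borel \<Otimes>\<^sub>M borel) (\<lambda>\<omega>. (\<eta> \<omega>, U \<omega>)) = distr M borel \<eta> \<Otimes>\<^sub>M distr M borel U"
    using ell by (auto simp: elliptical_def)
  have [measurable]: "(*v) A \<in> borel_measurable borel"
    by (intro borel_measurable_continuous_onI continuous_intros)
  have S: "prob_space (sphere_uniform :: (real ^ 'r) measure)"
    unfolding U[symmetric] by (rule prob_space.prob_space_distr[OF M]) measurable
  define w where "w z = sgn (transpose A *v z)" for z
  have law: "distr P borel (\<lambda>x. (z \<bullet> x) / sqrt (z \<bullet> (\<Gamma> *v z)))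
      = distr (distr M borel \<eta> \<Otimes>\<^sub>M sphere_uniform) borel (\<lambda>(e, y). e * (w z \<bullet> y))" for z
  proof -
    have "(z \<bullet> (\<eta> \<omega> *\<^sub>R (A *v U \<omega>))) / sqrt (z \<bullet> (\<Gamma> *v z)) = \<eta> \<omega> * (w z \<bullet> U \<omega>)" for \<omega>
      unfolding \<Gamma> quadratic_form_gram w_def sgn_div_norm
      by (simp add: dot_lmul_matrix[symmetric] transpose_matrix_vector divide_inverse)
    then have "distr P borel (\<lambda>x. (z \<bullet> x) / sqrt (z \<bullet> (\<Gamma> *v z)))
        = distr M borel (\<lambda>\<omega>. \<eta> \<omega> * (w z \<bullet> U \<omega>))"
      unfolding P by (subst distr_distr) (auto simp: comp_def)
    also have "\<dots> = distr (distr M (borel \<Otimes>\<^sub>M borel) (\<lambda>\<omega>. (\<eta> \<omega>, U \<omega>))) borel (\<lambda>(e, y). e * (w z \<bullet> y))"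
      by (subst distr_distr) (auto simp: comp_def)
    finally show ?thesis by (simp add: indep U)
  qed
  have "transpose A *v u \<noteq> 0" "transpose A *v v \<noteq> 0"
    using pos by (auto simp: \<Gamma> quadratic_form_gram)
  then have "norm (w u) = norm (w v)" by (simp add: w_def norm_sgn)
  then show ?thesis
    unfolding law by (intro distr_pair_sphere_uniform_inner S) simp_all
qed

text \<open>
  Well-definedness of \<open>G\<close>: the value described by \<^const>\<open>marginal_cdf\<close> exists.
\<close>

lemma marginal_cdf_eq:
  fixes P :: "(real ^ 'p::finite) measure"
  assumes ell: "elliptical (R :: 'r::finite itself) M P \<Gamma> \<eta>"
    and pos: "\<And>u. u \<in> sphere 0 1 \<Longrightarrow> u \<bullet> (\<Gamma> *v u) > 0"
    and u: "u \<in> sphere 0 1"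
  shows "marginal_cdf P \<Gamma> t = measure P {x \<in> space P. \<bar>u \<bullet> x\<bar>\<^sup>2 / (u \<bullet> (\<Gamma> *v u)) \<le> t}"
proof -
  note sP = elliptical_space_sets[OF ell]
  note [measurable_cong] = sP(1)
  have law: "measure P {x \<in> space P. \<bar>z \<bullet> x\<bar>\<^sup>2 / (z \<bullet> (\<Gamma> *v z)) \<le> t}
      = measure (distr P borel (\<lambda>x. (z \<bullet> x) / sqrt (z \<bullet> (\<Gamma> *v z)))) {s. s\<^sup>2 \<le> t}"
    if "z \<in> sphere 0 1" for z
  proof -
    have "{s \<in> space borel. s\<^sup>2 \<le> t} \<in> sets borel" by measurable
    then have "{s::real. s\<^sup>2 \<le> t} \<in> sets borel" by simp
    moreover have "((z \<bullet> x) / sqrt (z \<bullet> (\<Gamma> *v z)))\<^sup>2 = \<bar>z \<bullet> x\<bar>\<^sup>2 / (z \<bullet> (\<Gamma> *v z))" for x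
      using pos[OF that] by (simp add: power_divide)
    ultimately show ?thesis
      by (simp add: measure_distr sP vimage_def)
  qed
  have "measure P {x \<in> space P. \<bar>z \<bullet> x\<bar>\<^sup>2 / (z \<bullet> (\<Gamma> *v z)) \<le> t}
      = measure P {x \<in> space P. \<bar>u \<bullet> x\<bar>\<^sup>2 / (u \<bullet> (\<Gamma> *v u)) \<le> t}" if "z \<in> sphere 0 1" for z
    unfolding law[OF that] law[OF u] distr_elliptical_direction[OF ell pos[OF that] pos[OF u]] ..
  then show ?thesis
    unfolding marginal_cdf_def using u by (intro the_equality) (blast, drule bspec[OF _ u], rule sym)
qed

section \<open>Depth\<close>

text \<open>
  Continuity of the distribution function at \<open>c\<close> means that \<open>Y\<close> has no atom there, so the
  event \<open>Y \<ge> c\<close> has the same probability as the complement of \<open>Y \<le> c\<close>.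
\<close>

lemma (in prob_space) prob_ge_eq_of_isCont:
  fixes Y :: "'a \<Rightarrow> real"
  assumes Y[measurable]: "Y \<in> borel_measurable M"
    and cont: "isCont (\<lambda>t. prob {x \<in> space M. Y x \<le> t}) c"
  shows "prob {x \<in> space M. Y x \<ge> c} = 1 - prob {x \<in> space M. Y x \<le> c}"
proof -
  interpret D: real_distribution "distr M borel Y" by (rule real_distribution_distr) (rule Y)
  have "cdf (distr M borel Y) = (\<lambda>t. prob {x \<in> space M. Y x \<le> t})"
    by (auto simp: cdf_def measure_distr intro!: ext arg_cong[where f=prob])
  with cont have "measure (distr M borel Y) {c} = 0"
    by (simp add: D.isCont_cdf[symmetric])
  moreover have "Y -` {c} \<inter> space M = {x \<in> space M. Y x = c}" by auto
  ultimately have atom: "prob {x \<in> space M. Y x = c} = 0"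
    by (simp add: measure_distr)
  have "prob {x \<in> space M. Y x \<ge> c}
      = prob ({x \<in> space M. \<not> Y x \<le> c} \<union> {x \<in> space M. Y x = c})"
    by (rule arg_cong[where f=prob]) auto
  also have "\<dots> = prob {x \<in> space M. \<not> Y x \<le> c}"
    by (subst finite_measure_Union) (auto simp: atom)
  also have "\<dots> = 1 - prob {x \<in> space M. Y x \<le> c}"
    by (rule prob_neg) measurable
  finally show ?thesis .
qed

theorem proposition4p2:
  fixes M :: "'w measure" and \<xi> \<eta> :: "'w \<Rightarrow> real"
    and P\<^sub>\<Gamma> :: "(real ^ 'p::finite) measure" and \<Sigma> \<Gamma> :: "real ^ 'p ^ 'p"
    and \<U> :: "(real ^ 'p) set"
  assumes "elliptical TYPE('r::finite) M P\<^sub>\<Gamma> \<Sigma> \<xi>"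
    and "s_min \<Sigma> > 0"
    and "canonical_representation TYPE('r) M P\<^sub>\<Gamma> \<Gamma> \<eta> \<Sigma> \<xi>"
    and "marginal_condition P\<^sub>\<Gamma> \<Gamma>"
    and "\<U> \<noteq> {}" and "\<U> \<subseteq> sphere 0 1"
  shows "matrix_depth \<U> \<Gamma> P\<^sub>\<Gamma> = 1 / 2"
proof -
  have ell: "elliptical TYPE('r) M P\<^sub>\<Gamma> \<Gamma> \<eta>" and G1: "marginal_cdf P\<^sub>\<Gamma> \<Gamma> 1 = 1 / 2"
    using assms(3) by (auto simp: canonical_representation_def)
  obtain a where a: "a > 0" "\<Gamma> = (1 / a\<^sup>2) *\<^sub>R \<Sigma>"
    using assms(3) by (auto simp: canonical_representation_def)
  have cont: "isCont (marginal_cdf P\<^sub>\<Gamma> \<Gamma>) 1"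
    using assms(4) by (simp add: marginal_condition_def Let_def)
  interpret P: prob_space P\<^sub>\<Gamma> by (rule prob_space_elliptical[OF ell])
  note [measurable_cong] = elliptical_space_sets(1)[OF ell]
  obtain A :: "real ^ 'r ^ 'p" where A: "\<Sigma> = A ** transpose A"
    using assms(1) by (auto simp: elliptical_def)
  have pos: "u \<bullet> (\<Gamma> *v u) > 0" if "u \<in> sphere 0 1" for u
  proof -
    have "u \<noteq> 0" using that by auto
    then have "\<Sigma> *v u \<noteq> 0" by (rule s_min_pos_imp_mult_nonzero[OF assms(2)])
    then have "transpose A *v u \<noteq> 0"
      by (auto simp: A matrix_vector_mul_assoc[symmetric])
    then have "u \<bullet> (\<Sigma> *v u) > 0" by (simp add: A quadratic_form_gram)
    then show ?thesis using a by (simp add: scaleR_matrix_vector_assoc[symmetric])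
  qed
  have half: "min (measure P\<^sub>\<Gamma> {x \<in> space P\<^sub>\<Gamma>. \<bar>u \<bullet> x\<bar>\<^sup>2 \<le> u \<bullet> (\<Gamma> *v u)})
                  (measure P\<^sub>\<Gamma> {x \<in> space P\<^sub>\<Gamma>. \<bar>u \<bullet> x\<bar>\<^sup>2 \<ge> u \<bullet> (\<Gamma> *v u)}) = 1 / 2"
    if "u \<in> \<U>" for u
  proof -
    have u: "u \<in> sphere 0 1" using that assms(6) by blast
    let ?Y = "\<lambda>x. \<bar>u \<bullet> x\<bar>\<^sup>2 / (u \<bullet> (\<Gamma> *v u))"
    have G: "marginal_cdf P\<^sub>\<Gamma> \<Gamma> = (\<lambda>t. P.prob {x \<in> space P\<^sub>\<Gamma>. ?Y x \<le> t})"
      using marginal_cdf_eq[OF ell pos u] by blast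
    have le: "P.prob {x \<in> space P\<^sub>\<Gamma>. ?Y x \<le> 1} = 1 / 2"
      using G1 unfolding G .
    have "P.prob {x \<in> space P\<^sub>\<Gamma>. ?Y x \<ge> 1} = 1 - P.prob {x \<in> space P\<^sub>\<Gamma>. ?Y x \<le> 1}"
      by (rule P.prob_ge_eq_of_isCont) (use cont in \<open>simp_all add: G\<close>)
    with le show ?thesis
      using pos[OF u] by (simp add: field_simps)
  qed
  then have "matrix_depth \<U> \<Gamma> P\<^sub>\<Gamma> = (INF u\<in>\<U>. 1 / 2)"
    unfolding matrix_depth_def by (intro INF_cong refl)
  then show ?thesis using assms(5) by simp
qed

end
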